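(* For each integer $k\ge 3$, let $\lambda_k$ denote the unique positive real root of the polynomial $X^{k}-\sum_{j=0}^{k-2}X^{j}$. Then $$\lim_{k\to\infty}\lambda_k=\phi,\qquad \phi=\frac{1+\sqrt5}{2}.$$
   Context: For every integer $k\ge 3$ the polynomial $X^{k}-\sum_{j=0}^{k-2}X^{j}=X^k-X^{k-2}-\cdots-X-1$ has exactly one positive real root, denoted $\lambda_k$. *)

theory Defs
  imports "HOL-Analysis.Analysis" "HOL-Computational_Algebra.Polynomial"
begin

definition lambda_poly :: "nat \<Rightarrow> real poly" where
  "lambda_poly k = monom 1 k - (\<Sum>j=0..k-2. monom 1 j)"

(* Only meaningful for k \<ge> 3 (see lambda_poly_unique_root); a limit as k tends to
   infinity ignores the remaining values. *)
definition lambda_root :: "nat \<Rightarrow> real" where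
  "lambda_root k = (THE x. x > 0 \<and> poly (lambda_poly k) x = 0)"

lemma poly_lambda_poly: "poly (lambda_poly k) x = x ^ k - (\<Sum>j=0..k-2. x ^ j)"
  by (simp add: lambda_poly_def poly_sum poly_monom)

lemma lambda_poly_root_not_less:
  assumes "k \<ge> 3" "0 < x" "x < y"
    and "poly (lambda_poly k) x = 0" "poly (lambda_poly k) y = 0"
  shows False
proof -
  define r where "r = y / x"
  have r: "r > 1" "y = r * x" using assms by (auto simp: r_def)
  have "(\<Sum>j=0..k-2. y ^ j) < (\<Sum>j=0..k-2. r ^ k * x ^ j)"
  proof (rule sum_strict_mono)
    fix j assume "j \<in> {0..k-2}"
    then have "j < k" using assms(1) by auto
    then have "r ^ j < r ^ k" using r(1) by (simp add: power_strict_increasing)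
    then show "y ^ j < r ^ k * x ^ j" using assms(2) r(2) by (simp add: power_mult_distrib)
  qed auto
  also have "\<dots> = r ^ k * x ^ k"
    using assms(4) by (simp add: poly_lambda_poly sum_distrib_left [symmetric])
  also have "\<dots> = y ^ k" by (simp add: r(2) power_mult_distrib)
  finally show False using assms(5) by (simp add: poly_lambda_poly)
qed

lemma lambda_poly_unique_root:
  assumes "k \<ge> 3"
  shows "\<exists>!x. x > 0 \<and> poly (lambda_poly k) x = 0"
proof -
  have neg: "poly (lambda_poly k) 0 < 0"
    using assms by (simp add: poly_lambda_poly power_0_left)
  have "(\<Sum>j=0..k-2. (2::real) ^ j) = (\<Sum>j<Suc (k-2). 2 ^ j)"
    by (rule sum.cong) auto
  also have "\<dots> = 2 ^ Suc (k-2) - 1"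
    by (subst sum_gp_strict) auto
  also have "\<dots> < 2 ^ k"
    using power_increasing[of "Suc (k-2)" k "2::real"] assms by linarith
  finally have pos: "poly (lambda_poly k) 2 > 0" by (simp add: poly_lambda_poly)
  obtain x where "x > 0" "poly (lambda_poly k) x = 0"
    using poly_IVT_pos[OF _ neg pos] by auto
  then show ?thesis
    using lambda_poly_root_not_less[OF assms] by (metis linorder_neqE_linordered_idom)
qed

end

theory Submission
  imports Defs
begin

text \<open>
  Write \<open>p\<^sub>k\<close> for the polynomial and \<open>\<phi>\<close> for the golden ratio. Summing the geometric series gives
  \<open>(x - 1) p\<^sub>k(x) = x\<^bsup>k-1\<^esup> (x\<^sup>2 - x - 1) + 1\<close>.
  At \<open>\<phi>\<close> the quadratic factor vanishes, so \<open>p\<^sub>k(\<phi>) > 0\<close> for every \<open>k\<close>. At a fixed \<open>b\<close> with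
  \<open>1 < b < \<phi>\<close> the quadratic factor is negative and the power grows without bound, so
  \<open>p\<^sub>k(b) < 0\<close> as soon as \<open>k\<close> is large. The intermediate value theorem and the uniqueness of the
  positive root then place the root strictly between \<open>b\<close> and \<open>\<phi>\<close>; since \<open>b\<close> may be taken
  arbitrarily close to \<open>\<phi>\<close>, the roots converge to \<open>\<phi>\<close> from below.
\<close>

lemma lambda_poly_times_linear:
  assumes "k \<ge> 2"
  shows "(x - 1) * poly (lambda_poly k) x = x ^ (k - 1) * (x\<^sup>2 - x - 1) + 1"
proof -
  obtain n where k: "k = n + 2"
    using assms by (metis add.commute le_Suc_ex)
  have geometric: "(x - 1) * (\<Sum>j=0..n. x ^ j) = x ^ Suc n - 1"
    by (induction n) (auto simp: algebra_simps)
  have "(x - 1) * poly (lambda_poly k) x = (x - 1) * x ^ (n + 2) - (x ^ Suc n - 1)"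
    unfolding geometric [symmetric] by (simp add: poly_lambda_poly k algebra_simps)
  also have "\<dots> = x ^ (k - 1) * (x\<^sup>2 - x - 1) + 1"
    by (simp add: k power2_eq_square algebra_simps)
  finally show ?thesis .
qed

lemma lambda_root_between:
  assumes "k \<ge> 3" "0 < a" "a < b"
    and "poly (lambda_poly k) a < 0" "poly (lambda_poly k) b > 0"
  shows "a < lambda_root k" "lambda_root k < b"
proof -
  obtain x where x: "a < x" "x < b" "poly (lambda_poly k) x = 0"
    using poly_IVT_pos[OF assms(3-5)] by blast
  have "lambda_root k = x"
    unfolding lambda_root_def
    by (rule the1_equality[OF lambda_poly_unique_root[OF assms(1)]]) (use x assms(2) in auto)
  with x show "a < lambda_root k" "lambda_root k < b" by simp_all
qed

lemma golden_ratio_gt_1: "1 < (1 + sqrt 5) / 2"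
  using real_less_rsqrt[of 1 5] by simp

lemma golden_quadratic_factor:
  "x\<^sup>2 - x - 1 = (x - (1 + sqrt 5) / 2) * (x - (1 - sqrt 5) / 2)"
  by (simp add: power2_eq_square field_simps)

lemma lambda_poly_golden_ratio_pos:
  assumes "k \<ge> 2"
  shows "poly (lambda_poly k) ((1 + sqrt 5) / 2) > 0"
proof -
  have "((1 + sqrt 5) / 2 - 1) * poly (lambda_poly k) ((1 + sqrt 5) / 2) = 1"
    by (subst lambda_poly_times_linear[OF assms], subst golden_quadratic_factor) simp
  moreover have "(1 + sqrt 5) / 2 - 1 > 0"
    using golden_ratio_gt_1 by simp
  ultimately show ?thesis
    by (metis zero_less_mult_pos zero_less_one)
qed

lemma eventually_lambda_poly_neg:
  assumes "1 < b" "b < (1 + sqrt 5) / 2"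
  shows "eventually (\<lambda>k. poly (lambda_poly k) b < 0) sequentially"
proof -
  have "sqrt 5 > 1" using golden_ratio_gt_1 by simp
  then have factor_neg: "b\<^sup>2 - b - 1 < 0"
    unfolding golden_quadratic_factor using assms by (intro mult_neg_pos) (auto simp: field_simps)
  have "filterlim (\<lambda>k. b ^ k) at_top sequentially"
    using assms(1)
    by (intro filterlim_at_infinity_imp_filterlim_at_top filterlim_realpow_sequentially_gt1) auto
  \<comment> \<open>The extra factor \<open>b\<close> turns the exponent \<open>k - 1\<close> into \<open>k\<close>.\<close>
  then have "eventually (\<lambda>k. b ^ k > b / (1 + b - b\<^sup>2)) sequentially"
    by (simp add: filterlim_at_top_dense)
  with eventually_ge_at_top[of 2] show ?thesis
  proof eventually_elim
    case (elim k)
    have "b < b ^ k * (1 + b - b\<^sup>2)"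
      using elim(2) factor_neg by (simp add: pos_divide_less_eq)
    also have "b ^ k = b * b ^ (k - 1)"
      using elim(1) by (simp add: power_eq_if)
    finally have "b * 1 < b * (b ^ (k - 1) * (1 + b - b\<^sup>2))" by (simp add: mult.assoc)
    then have "1 < b ^ (k - 1) * (1 + b - b\<^sup>2)" using assms(1) by simp
    then have "(b - 1) * poly (lambda_poly k) b < 0"
      unfolding lambda_poly_times_linear[OF elim(1)] by (simp add: algebra_simps)
    then show ?case using assms(1) by (simp add: mult_less_0_iff)
  qed
qed

lemma eventually_lambda_root_between:
  assumes "1 < b" "b < (1 + sqrt 5) / 2"
  shows "eventually (\<lambda>k. b < lambda_root k \<and> lambda_root k < (1 + sqrt 5) / 2) sequentially"
  using eventually_lambda_poly_neg[OF assms] eventually_ge_at_top[of 3]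
proof eventually_elim
  case (elim k)
  have "poly (lambda_poly k) ((1 + sqrt 5) / 2) > 0" "0 < b"
    using lambda_poly_golden_ratio_pos[of k] elim(2) assms(1) by simp_all
  then show ?case
    using lambda_root_between[OF elim(2) _ assms(2) elim(1)] by blast
qed

theorem mainTheorem1:
  shows "lambda_root \<longlonglongrightarrow> (1 + sqrt 5) / 2"
proof (rule order_tendstoI)
  fix a assume "a < (1 + sqrt 5) / 2"
  then obtain b where "max 1 a < b" "b < (1 + sqrt 5) / 2"
    using dense[of "max 1 a" "(1 + sqrt 5) / 2"] golden_ratio_gt_1 by (meson max_less_iff_conj)
  then show "eventually (\<lambda>k. a < lambda_root k) sequentially"
    using eventually_lambda_root_between[of b] by (auto elim: eventually_mono)
next
  fix a assume "(1 + sqrt 5) / 2 < a"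
  moreover obtain b where "1 < b" "b < (1 + sqrt 5) / 2"
    using dense[OF golden_ratio_gt_1] by blast
  ultimately show "eventually (\<lambda>k. lambda_root k < a) sequentially"
    using eventually_lambda_root_between[of b] by (auto elim: eventually_mono)
qed

end
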